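(* Each of the following classes of cooperative games is stable under the partial composition operations $\circ_i$ and thus forms a (set-theoretic) suboperad of the operad of cooperative games: (1) normalized games; and simple monotone games; (2) non-negative monotone games (capacities); (3) non-negative convex games; and more generally, for each $k\ge2$, non-negative $k$-monotone games; (4) non-negative monotone submodular games; and more generally, for each $k\geq 2$, non-negative monotone $k$-alternating games; (5) belief functions, i.e. non-negative $\infty$-monotone games; and plausibility measures, i.e. non-negative monotone $\infty$-alternating games; (6) non-negative monotone balanced games.
   Context: A game is a pair $\Gamma=(N,v)$, $N$ a nonempty finite totally ordered set of players, $v:\mathcal P(N)\to\mathbb R$ with $v(\emptyset)=0$. For games $(A,\alpha)$, $(B,\beta)$ with disjoint player sets and $i\in A$, the game $(A,\alpha)\circ_i(B,\beta)$ has player set $A\diamond_iB=(A\setminus\{i\})\cup B$ ($B$ inserted in order in the place of $i$) and coalition function $$(\alpha\circ_i\beta)(S)=\beta(B)\alpha(S\cap A)+\partial_i\alpha(S\cap A)\,\beta(S\cap B),\qquad \partial_i\alpha(T)=\alpha(T\cup\{i\})-\alpha(T\setminus\{i\}).$$ The symmetric group $\mathbb S_n$ acts on games on $[n]$ by $(\sigma\star v)(S)=v(\sigma^{-1}(S))$, and the operadic unit is the $1$-player game with value $1$ on its player. A suboperad is a class of games containing the unit and stable under the symmetric group actions and all the $\circ_i$. A game $(N,v)$ is: normalized if $v(N)=1$; simple if $v(S)\in\{0,1\}$ for all $S$; non-negative if $v(S)\ge0$ for all $S$; monotone if $v(S)\le v(T)$ whenever $S\subseteq T$; convex if $v(S)+v(T)\le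 v(S\cup T)+v(S\cap T)$ for all $S,T$; submodular if $v(S)+v(T)\ge v(S\cup T)+v(S\cap T)$ for all $S,T$; $k$-monotone ($k\ge2$) if for all $A_1,\dots,A_k\subseteq N$ $$v\Big(\bigcup_{j=1}^kA_j\Big)\ge\sum_{\emptyset\ne I\subseteq[k]}(-1)^{|I|+1}v\Big(\bigcap_{j\in I}A_j\Big);$$ $k$-alternating ($k\ge2$) if for all $A_1,\dots,A_k\subseteq N$ $$v\Big(\bigcap_{j=1}^kA_j\Big)\le\sum_{\emptyset\ne I\subseteq[k]}(-1)^{|I|+1}v\Big(\bigcup_{j\in I}A_j\Big);$$ $\infty$-monotone (resp. $\infty$-alternating) if it is $k$-monotone (resp. $k$-alternating) for all $k\ge2$. A collection $\mathcal B\subseteq\mathcal P(N)$ is balanced over $N$ if there are weights $\lambda_S\in(0,1]$, $S\in\mathcal B$, with $\sum_{S\in\mathcal B}\lambda_S\mathbf 1^S=\mathbf 1^N$ ($\mathbf 1^S\in\mathbb R^N$ the indicator vector); $(N,v)$ is balanced if $\sum_{S\in\mathcal B}\lambda_Sv(S)\le v(N)$ for all balanced collections $\mathcal B$ over $N$ and all such weights. *)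

theory Defs
  imports Complex_Main "HOL-Library.FuncSet" "HOL-Library.Indicator_Function"
    "HOL-Combinatorics.Permutations"
begin

text \<open>
  A finite totally ordered player set is given by the list of its players in increasing order
  (this order is not an order on the player type: composition rearranges it).
  The coalition function is \<^const>\<open>undefined\<close> outside the coalitions of the game, so that
  equality of records is equality of games.
\<close>

record 'a game =
  players :: "'a list"
  worth :: "'a set \<Rightarrow> real"

abbreviation pset :: "'a game \<Rightarrow> 'a set" where
  "pset G \<equiv> set (players G)"

definition games :: "'a game set" where
  "games = {G. players G \<noteq> [] \<and> distinct (players G) \<and>
               worth G \<in> extensional (Pow (pset G)) \<and> worth G {} = 0}"

definition marginal :: "'a \<Rightarrow> ('a set \<Rightarrow> real) \<Rightarrow> 'a set \<Rightarrow> real" where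
  "marginal i \<alpha> T = \<alpha> (insert i T) - \<alpha> (T - {i})"

definition insert_at :: "'a list \<Rightarrow> 'a \<Rightarrow> 'a list \<Rightarrow> 'a list" where
  "insert_at xs i ys = concat (map (\<lambda>x. if x = i then ys else [x]) xs)"

lemma set_insert_at: "i \<in> set xs \<Longrightarrow> set (insert_at xs i ys) = (set xs - {i}) \<union> set ys"
  by (auto simp: insert_at_def split: if_splits)

definition game_comp :: "'a game \<Rightarrow> 'a \<Rightarrow> 'a game \<Rightarrow> 'a game" where
  "game_comp G i H =
     (let A = pset G; B = pset H; \<alpha> = worth G; \<beta> = worth H; C = insert_at (players G) i (players H)
      in \<lparr>players = C,
          worth = (\<lambda>S\<in>Pow (set C). \<beta> B * \<alpha> (S \<inter> A) + marginal i \<alpha> (S \<inter> A) * \<beta> (S \<inter> B))\<rparr>)"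

text \<open>
  The permutation moves the coalition function and leaves the ordered player set in place.
  For the player list \<open>[1, \<dots>, n]\<close> this is the action of the symmetric group on games on
  \<open>[n]\<close>; on any other ordered player set it is the same action, read through the permutations
  of that set.
\<close>

definition perm_game :: "('a \<Rightarrow> 'a) \<Rightarrow> 'a game \<Rightarrow> 'a game" where
  "perm_game \<sigma> G =
     \<lparr>players = players G, worth = (\<lambda>S\<in>Pow (pset G). worth G (inv \<sigma> ` S))\<rparr>"

definition unit_game :: "'a \<Rightarrow> 'a game" where
  "unit_game a = \<lparr>players = [a], worth = (\<lambda>S\<in>Pow {a}. if S = {a} then 1 else 0)\<rparr>"

definition suboperad :: "'a game set \<Rightarrow> bool" where
  "suboperad \<C> \<longleftrightarrow>
     \<C> \<subseteq> games \<and>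
     (\<forall>a. unit_game a \<in> \<C>) \<and>
     (\<forall>G\<in>\<C>. \<forall>\<sigma>. \<sigma> permutes pset G \<longrightarrow> perm_game \<sigma> G \<in> \<C>) \<and>
     (\<forall>G\<in>\<C>. \<forall>H\<in>\<C>. pset G \<inter> pset H = {} \<longrightarrow> (\<forall>i\<in>pset G. game_comp G i H \<in> \<C>))"

definition normalized :: "'a game \<Rightarrow> bool" where
  "normalized G \<longleftrightarrow> worth G (pset G) = 1"

definition simple_game :: "'a game \<Rightarrow> bool" where
  "simple_game G \<longleftrightarrow> (\<forall>S\<subseteq>pset G. worth G S \<in> {0, 1})"

definition nonneg_game :: "'a game \<Rightarrow> bool" where
  "nonneg_game G \<longleftrightarrow> (\<forall>S\<subseteq>pset G. worth G S \<ge> 0)"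

definition monotone_game :: "'a game \<Rightarrow> bool" where
  "monotone_game G \<longleftrightarrow> (\<forall>T\<subseteq>pset G. \<forall>S\<subseteq>T. worth G S \<le> worth G T)"

definition convex_game :: "'a game \<Rightarrow> bool" where
  "convex_game G \<longleftrightarrow>
     (\<forall>S\<subseteq>pset G. \<forall>T\<subseteq>pset G. worth G S + worth G T \<le> worth G (S \<union> T) + worth G (S \<inter> T))"

definition submodular_game :: "'a game \<Rightarrow> bool" where
  "submodular_game G \<longleftrightarrow>
     (\<forall>S\<subseteq>pset G. \<forall>T\<subseteq>pset G. worth G S + worth G T \<ge> worth G (S \<union> T) + worth G (S \<inter> T))"

definition k_monotone :: "nat \<Rightarrow> 'a game \<Rightarrow> bool" where
  "k_monotone k G \<longleftrightarrow>
     (\<forall>A :: nat \<Rightarrow> 'a set. (\<forall>j\<in>{1..k}. A j \<subseteq> pset G) \<longrightarrow>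
        worth G (\<Union>j\<in>{1..k}. A j) \<ge>
        (\<Sum>I\<in>Pow {1..k} - {{}}. (-1) ^ (card I + 1) * worth G (\<Inter>j\<in>I. A j)))"

definition k_alternating :: "nat \<Rightarrow> 'a game \<Rightarrow> bool" where
  "k_alternating k G \<longleftrightarrow>
     (\<forall>A :: nat \<Rightarrow> 'a set. (\<forall>j\<in>{1..k}. A j \<subseteq> pset G) \<longrightarrow>
        worth G (\<Inter>j\<in>{1..k}. A j) \<le>
        (\<Sum>I\<in>Pow {1..k} - {{}}. (-1) ^ (card I + 1) * worth G (\<Union>j\<in>I. A j)))"

definition inf_monotone :: "'a game \<Rightarrow> bool" where
  "inf_monotone G \<longleftrightarrow> (\<forall>k\<ge>2. k_monotone k G)"

definition inf_alternating :: "'a game \<Rightarrow> bool" where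
  "inf_alternating G \<longleftrightarrow> (\<forall>k\<ge>2. k_alternating k G)"

text \<open>A collection is balanced over \<open>N\<close> iff it has a system of balancing weights.\<close>

definition balancing_weights :: "'a set \<Rightarrow> 'a set set \<Rightarrow> ('a set \<Rightarrow> real) \<Rightarrow> bool" where
  "balancing_weights N \<B> l \<longleftrightarrow>
     \<B> \<subseteq> Pow N \<and> (\<forall>S\<in>\<B>. 0 < l S \<and> l S \<le> 1) \<and>
     (\<forall>p\<in>N. (\<Sum>S\<in>\<B>. l S * indicator S p) = 1)"

definition balanced_game :: "'a game \<Rightarrow> bool" where
  "balanced_game G \<longleftrightarrow>
     (\<forall>\<B> l. balancing_weights (pset G) \<B> l \<longrightarrow>
        (\<Sum>S\<in>\<B>. l S * worth G S) \<le> worth G (pset G))"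

end

theory Submission
  imports Defs
begin

text \<open>
  Write \<open>S\<^sub>A\<close> and \<open>S\<^sub>B\<close> for the parts of a coalition \<open>S\<close> in \<open>A - {i}\<close> and in \<open>B\<close>. Everything rests
  on the regrouping
  \<open>(\<alpha> \<circ>\<^sub>i \<beta>)(S) = (\<beta>(B) - \<beta>(S\<^sub>B)) \<alpha>(S\<^sub>A) + \<beta>(S\<^sub>B) \<alpha>(S\<^sub>A \<union> {i})\<close>
  of the composite: when \<open>\<beta>\<close> is monotone and non-negative, the coefficients are non-negative and
  add up to \<open>\<beta>(B)\<close>. Normalized games, simple monotone games and capacities can be read off from
  this formula.

  For \<open>k\<close>-monotone games, the inclusion-exclusion inequality says that a mixed difference of
  order \<open>k\<close> is non-negative. With non-negativity of the game, all mixed differences of orders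
  \<open>0, \<dots>, k\<close> at all base points are then non-negative, and conversely
  (\<open>nonneg_k_monotone_iff_total_mono\<close>). A mixed difference of the composite splits into mixed
  differences taken separately in the variables \<open>S\<^sub>A\<close> and \<open>S\<^sub>B\<close> (\<open>mdiff_two_arg_nonneg\<close>). If none
  of the differences is taken in \<open>S\<^sub>B\<close>, the regrouped formula applies. If at least one is, only
  the term \<open>\<partial>\<^sub>i\<alpha>(S\<^sub>A) \<beta>(S\<^sub>B)\<close> survives, and it becomes a product of a difference of \<open>\<beta>\<close> and one of
  \<open>\<alpha>\<close>; the latter contains the additional difference in the player \<open>i\<close>, but it lost one in
  \<open>S\<^sub>A\<close>, so that its order is still at most \<open>k\<close>.

  Alternating games reduce to monotone ones: the dual game \<open>S \<mapsto> v(N) - v(N - S)\<close> exchanges the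
  two notions, and duality commutes with composition (\<open>composable.dual_comp\<close>). Convex and
  submodular games are the case \<open>k = 2\<close>; belief functions and plausibility measures are
  intersections over all \<open>k\<close>.

  For balanced games, let \<open>\<lambda>\<close> be balancing weights for the composite. Each \<open>S\<close> of the collection
  contributes to the outer game the coalition \<open>S\<^sub>A \<union> {i}\<close> with weight \<open>\<lambda>\<^sub>S \<beta>(S\<^sub>B)\<close> and the coalition
  \<open>S\<^sub>A\<close> with weight \<open>\<lambda>\<^sub>S (\<beta>(B) - \<beta>(S\<^sub>B))\<close>. A player of \<open>A - {i}\<close> is covered with total weight
  \<open>\<beta>(B)\<close>. The player \<open>i\<close> is covered with total weight \<open>\<Sum>\<lambda>\<^sub>S \<beta>(S\<^sub>B)\<close>, which is at most \<open>\<beta>(B)\<close> because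
  \<open>\<beta>\<close> is balanced; the deficit may be filled by the singleton \<open>{i}\<close>, as \<open>\<alpha>\<close> is non-negative.
  Balancedness of \<open>\<alpha>\<close> now bounds the weighted sum by \<open>\<beta>(B) \<alpha>(A)\<close>, the worth of the grand
  coalition of the composite.
\<close>

section \<open>Suboperads and the composition of games\<close>

lemma insert_at_absent: "i \<notin> set xs \<Longrightarrow> insert_at xs i ys = xs"
  by (induction xs) (auto simp: insert_at_def)

lemma distinct_insert_at:
  assumes "distinct xs" "distinct ys" "set xs \<inter> set ys = {}"
  shows "distinct (insert_at xs i ys)"
  using assms
proof (induction xs)
  case Nil
  then show ?case by (simp add: insert_at_def)
next
  case (Cons x xs)
  have step: "insert_at (x # xs) i ys = (if x = i then ys else [x]) @ insert_at xs i ys"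
    by (simp add: insert_at_def)
  have sub: "set (insert_at xs i ys) \<subseteq> set xs \<union> set ys"
    by (auto simp: insert_at_def)
  show ?case
  proof (cases "x = i")
    case True
    then have "insert_at xs i ys = xs" using Cons.prems by (simp add: insert_at_absent)
    with True Cons.prems step show ?thesis by auto
  next
    case False
    with Cons step sub show ?thesis by auto
  qed
qed

locale composable =
  fixes G :: "'a game" and i :: 'a and H :: "'a game"
  assumes G: "G \<in> games" and H: "H \<in> games"
    and disjoint: "pset G \<inter> pset H = {}" and i: "i \<in> pset G"
begin

lemma pset_comp: "pset (game_comp G i H) = (pset G - {i}) \<union> pset H"
  by (simp add: game_comp_def Let_def set_insert_at i)

lemma outer_subset:
  "S \<inter> (pset G - {i}) \<subseteq> pset G" "insert i (S \<inter> (pset G - {i})) \<subseteq> pset G"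
  using i by auto

text \<open>Grouping by the values of the outer game makes positivity visible: up to the factor
  \<open>\<beta>(B)\<close>, the composite interpolates between the outer coalition without and with the player
  \<open>i\<close>, with the worth of \<open>S\<close> in the inner game as interpolation parameter.\<close>

lemma worth_comp:
  assumes "S \<subseteq> pset (game_comp G i H)"
  shows "worth (game_comp G i H) S =
    (worth H (pset H) - worth H (S \<inter> pset H)) * worth G (S \<inter> (pset G - {i})) +
    worth H (S \<inter> pset H) * worth G (insert i (S \<inter> (pset G - {i})))"
proof -
  have "i \<notin> S"
    using assms disjoint i unfolding pset_comp by auto
  then have "S \<inter> pset G = S \<inter> (pset G - {i})" by auto
  then show ?thesis
    using assms unfolding pset_comp
    by (simp add: game_comp_def Let_def set_insert_at i marginal_def algebra_simps)
qed

lemma comp_in_games: "game_comp G i H \<in> games"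
proof -
  have "distinct (players (game_comp G i H))"
    using G H disjoint by (simp add: game_comp_def Let_def games_def distinct_insert_at)
  moreover have "players (game_comp G i H) \<noteq> []"
    using pset_comp H by (force simp: games_def)
  moreover have "worth (game_comp G i H) \<in> extensional (Pow (pset (game_comp G i H)))"
    by (simp add: game_comp_def Let_def)
  moreover have "worth (game_comp G i H) {} = 0"
    using G H by (simp add: worth_comp games_def)
  ultimately show ?thesis by (simp add: games_def)
qed

lemma comp_grand_worth:
  "worth (game_comp G i H) (pset (game_comp G i H)) = worth G (pset G) * worth H (pset H)"
proof -
  have "((pset G - {i}) \<union> pset H) \<inter> pset H = pset H"
    and "insert i (((pset G - {i}) \<union> pset H) \<inter> (pset G - {i})) = pset G"
    using i by auto
  then show ?thesis
    by (simp add: worth_comp) (simp add: pset_comp)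
qed

end

lemma unit_game_simps [simp]:
  "players (unit_game a) = [a]"
  "S \<subseteq> {a} \<Longrightarrow> worth (unit_game a) S = indicator S a"
  by (auto simp: unit_game_def subset_singleton_iff)

lemma unit_game_in_games: "unit_game a \<in> games"
  by (simp add: games_def) (simp add: unit_game_def)

lemma perm_game_simps [simp]:
  "players (perm_game \<sigma> G) = players G"
  "S \<subseteq> pset G \<Longrightarrow> worth (perm_game \<sigma> G) S = worth G (inv \<sigma> ` S)"
  by (auto simp: perm_game_def)

lemma perm_game_in_games: "G \<in> games \<Longrightarrow> perm_game \<sigma> G \<in> games"
  by (simp add: games_def) (simp add: perm_game_def)

lemma inv_permutes_image_subset:
  assumes "\<sigma> permutes N" "S \<subseteq> N"
  shows "inv \<sigma> ` S \<subseteq> N"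
  using assms permutes_image[OF permutes_inv[OF assms(1)]] by blast

lemma suboperadI:
  assumes "\<And>a. P (unit_game a)"
    and "\<And>G \<sigma>. G \<in> games \<Longrightarrow> P G \<Longrightarrow> \<sigma> permutes pset G \<Longrightarrow> P (perm_game \<sigma> G)"
    and "\<And>G i H. composable G i H \<Longrightarrow> P G \<Longrightarrow> P H \<Longrightarrow> P (game_comp G i H)"
  shows "suboperad {G \<in> games. P G}"
  unfolding suboperad_def
proof (intro conjI ballI allI impI)
  fix G i H
  assume "G \<in> {G \<in> games. P G}" "H \<in> {G \<in> games. P G}" "pset G \<inter> pset H = {}" "i \<in> pset G"
  then have "composable G i H" "P G" "P H" by (simp_all add: composable_def)
  then show "game_comp G i H \<in> {G \<in> games. P G}"
    by (simp add: assms(3) composable.comp_in_games)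
qed (use assms(1,2) in \<open>auto simp: unit_game_in_games perm_game_in_games\<close>)

section \<open>Normalized games, simple games and capacities\<close>

lemma suboperad_normalized: "suboperad {G \<in> games. normalized G}"
proof (rule suboperadI)
  fix G :: "'a game" and \<sigma> assume "normalized G" "\<sigma> permutes pset G"
  then show "normalized (perm_game \<sigma> G)"
    by (simp add: normalized_def permutes_image permutes_inv)
next
  fix G i and H :: "'a game" assume "composable G i H" "normalized G" "normalized H"
  then show "normalized (game_comp G i H)"
    by (simp add: normalized_def composable.comp_grand_worth)
qed (simp add: normalized_def)

lemma monotone_perm_game:
  assumes "\<sigma> permutes pset G" "monotone_game G"
  shows "monotone_game (perm_game \<sigma> G)"
  unfolding monotone_game_def
proof (intro allI impI)
  fix T S assume "T \<subseteq> pset (perm_game \<sigma> G)" "S \<subseteq> T"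
  then show "worth (perm_game \<sigma> G) S \<le> worth (perm_game \<sigma> G) T"
    using assms inv_permutes_image_subset[OF assms(1)]
    by (simp add: monotone_game_def image_mono)
qed

lemma nonneg_perm_game:
  assumes "\<sigma> permutes pset G" "nonneg_game G"
  shows "nonneg_game (perm_game \<sigma> G)"
  using assms inv_permutes_image_subset[OF assms(1)] by (simp add: nonneg_game_def)

lemma nonneg_gameD: "nonneg_game G \<Longrightarrow> S \<subseteq> pset G \<Longrightarrow> 0 \<le> worth G S"
  by (simp add: nonneg_game_def)

lemma monotone_gameD:
  "monotone_game G \<Longrightarrow> S \<subseteq> T \<Longrightarrow> T \<subseteq> pset G \<Longrightarrow> worth G S \<le> worth G T"
  by (simp add: monotone_game_def)

lemma simple_imp_nonneg: "simple_game G \<Longrightarrow> nonneg_game G"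
  unfolding simple_game_def nonneg_game_def by (metis empty_iff insert_iff order_refl zero_le_one)

context composable
begin

lemma nonneg_comp:
  assumes "nonneg_game G" "nonneg_game H" "monotone_game H"
  shows "nonneg_game (game_comp G i H)"
  unfolding nonneg_game_def
proof (intro allI impI)
  fix S assume S: "S \<subseteq> pset (game_comp G i H)"
  show "worth (game_comp G i H) S \<ge> 0"
    unfolding worth_comp[OF S]
    using outer_subset nonneg_gameD[OF assms(1)] nonneg_gameD[OF assms(2)] monotone_gameD[OF assms(3)]
    by (intro add_nonneg_nonneg mult_nonneg_nonneg) simp_all
qed

lemma monotone_comp:
  assumes "monotone_game G" "nonneg_game H" "monotone_game H"
  shows "monotone_game (game_comp G i H)"
  unfolding monotone_game_def
proof (intro allI impI)
  fix T S assume T: "T \<subseteq> pset (game_comp G i H)" and ST: "S \<subseteq> T"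
  then have S: "S \<subseteq> pset (game_comp G i H)" by simp
  let ?a = "\<lambda>S. worth G (S \<inter> (pset G - {i}))"
  let ?ai = "\<lambda>S. worth G (insert i (S \<inter> (pset G - {i})))"
  let ?b = "\<lambda>S. worth H (S \<inter> pset H)"
  let ?c = "worth H (pset H)"
  have "?a S \<le> ?a T" "?ai S \<le> ?ai T" "?a T \<le> ?ai T"
    by (rule monotone_gameD[OF assms(1)]; use i ST in auto)+
  moreover have "0 \<le> ?b S" "?b S \<le> ?b T" "?b S \<le> ?c"
    using ST by (auto intro!: monotone_gameD[OF assms(3)] nonneg_gameD[OF assms(2)])
  \<comment> \<open>Enlarge the outer part of the coalition first, then the inner part: the latter moves
    weight from the smaller value \<open>?a T\<close> to the larger value \<open>?ai T\<close>.\<close>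
  ultimately have "(?c - ?b S) * ?a S + ?b S * ?ai S \<le> (?c - ?b S) * ?a T + ?b S * ?ai T"
    and "0 \<le> (?b T - ?b S) * (?ai T - ?a T)"
    by (auto intro!: add_mono mult_left_mono)
  then show "worth (game_comp G i H) S \<le> worth (game_comp G i H) T"
    unfolding worth_comp[OF S] worth_comp[OF T] by (simp add: algebra_simps)
qed

lemma simple_comp:
  assumes "simple_game G" "simple_game H" "monotone_game H"
  shows "simple_game (game_comp G i H)"
  unfolding simple_game_def
proof (intro allI impI)
  fix S assume S: "S \<subseteq> pset (game_comp G i H)"
  have G01: "worth G T \<in> {0, 1}" if "T \<subseteq> pset G" for T
    using assms(1) that by (simp add: simple_game_def)
  have "worth G (S \<inter> (pset G - {i})) \<in> {0, 1}"
    "worth G (insert i (S \<inter> (pset G - {i}))) \<in> {0, 1}"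
    using i by (intro G01; blast)+
  moreover have "worth H (S \<inter> pset H) \<in> {0, 1}" "worth H (pset H) \<in> {0, 1}"
    using assms(2) by (auto simp: simple_game_def)
  moreover have "worth H (S \<inter> pset H) \<le> worth H (pset H)"
    using assms(3) by (simp add: monotone_game_def)
  ultimately show "worth (game_comp G i H) S \<in> {0, 1}"
    unfolding worth_comp[OF S] by auto
qed

end

lemma monotone_unit_game: "monotone_game (unit_game a)"
  by (auto simp: monotone_game_def indicator_def)

lemma nonneg_unit_game: "nonneg_game (unit_game a)"
  by (auto simp: nonneg_game_def)

lemma suboperad_simple_monotone: "suboperad {G \<in> games. simple_game G \<and> monotone_game G}"
proof (rule suboperadI)
  fix a :: 'a
  show "simple_game (unit_game a) \<and> monotone_game (unit_game a)"
    by (auto simp: monotone_unit_game simple_game_def indicator_def)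
next
  fix G :: "'a game" and \<sigma> assume *: "simple_game G \<and> monotone_game G" "\<sigma> permutes pset G"
  then have "simple_game (perm_game \<sigma> G)"
    using inv_permutes_image_subset[OF *(2)] by (simp add: simple_game_def)
  with * show "simple_game (perm_game \<sigma> G) \<and> monotone_game (perm_game \<sigma> G)"
    by (simp add: monotone_perm_game)
next
  fix G i and H :: "'a game"
  assume "composable G i H" "simple_game G \<and> monotone_game G" "simple_game H \<and> monotone_game H"
  then show "simple_game (game_comp G i H) \<and> monotone_game (game_comp G i H)"
    by (simp add: composable.simple_comp composable.monotone_comp simple_imp_nonneg)
qed

lemma suboperad_capacities: "suboperad {G \<in> games. nonneg_game G \<and> monotone_game G}"
proof (rule suboperadI)
  fix G i and H :: "'a game"
  assume "composable G i H" "nonneg_game G \<and> monotone_game G" "nonneg_game H \<and> monotone_game H"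
  then show "nonneg_game (game_comp G i H) \<and> monotone_game (game_comp G i H)"
    by (simp add: composable.nonneg_comp composable.monotone_comp)
qed (simp_all add: nonneg_unit_game monotone_unit_game nonneg_perm_game monotone_perm_game)

section \<open>Mixed differences\<close>

text \<open>The alternating sum \<open>\<Sum>\<^sub>I (-1)\<^bsup>|I|\<^esup> f (X \<inter> \<Inter>\<^bsub>j\<in>I\<^esub> A\<^sub>j)\<close> of inclusion-exclusion, over all subsets \<open>I\<close>
  of the indices (\<open>mdiff_eq_sum\<close>). The recursion, which applies one difference operator
  \<open>f \<mapsto> (X \<mapsto> f X - f (X \<inter> A))\<close> after the other, lets identities between such sums be proved one set
  at a time.\<close>

fun mdiff :: "'a set list \<Rightarrow> ('a set \<Rightarrow> real) \<Rightarrow> 'a set \<Rightarrow> real" where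
  "mdiff [] f X = f X"
| "mdiff (A # As) f X = mdiff As f X - mdiff As f (X \<inter> A)"

lemma mdiff_cong:
  "(\<And>Y. Y \<subseteq> X \<Longrightarrow> f Y = g Y) \<Longrightarrow> mdiff As f X = mdiff As g X"
proof (induction As arbitrary: X)
  case (Cons A As)
  have "mdiff As f X = mdiff As g X" "mdiff As f (X \<inter> A) = mdiff As g (X \<inter> A)"
    by (rule Cons.IH, rule Cons.prems, blast)+
  then show ?case by simp
qed simp

lemma mdiff_linear:
  "mdiff As (\<lambda>X. c * f X + d * g X) X = c * mdiff As f X + d * mdiff As g X"
  by (induction As arbitrary: X) (simp_all add: algebra_simps)

text \<open>The recursion applies the operator of the first set to the outcome, this law to the
  argument: difference operators commute.\<close>

lemma mdiff_diff: "mdiff As (\<lambda>X. f X - f (X \<inter> A)) X = mdiff (A # As) f X"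
proof (induction As arbitrary: X)
  case (Cons B As)
  then show ?case by (simp add: Int_ac)
qed simp

lemma mdiff_const: "mdiff As (\<lambda>_. c) X = (if As = [] then c else 0)"
  by (induction As arbitrary: X) auto

lemma mdiff_image:
  assumes "inj f"
  shows "mdiff As (\<lambda>S. v (f ` S)) X = mdiff (map ((`) f) As) v (f ` X)"
  by (induction As arbitrary: X) (simp_all add: image_Int[OF assms])

lemma mdiff_insert_arg:
  "mdiff As (\<lambda>S. v (insert i S)) X = mdiff (map (insert i) As) v (insert i X)"
proof (induction As arbitrary: X)
  case (Cons A As)
  have "insert i X \<inter> insert i A = insert i (X \<inter> A)" by auto
  with Cons show ?case by simp
qed simp

lemma mdiff_insert_irrelevant:
  "i \<notin> X \<Longrightarrow> mdiff (map (insert i) As) v X = mdiff As v X"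
  by (induction As arbitrary: X) (simp_all)

lemma mdiff_indicator:
  "mdiff As (\<lambda>S. indicator S a) X = (if a \<in> X \<and> (\<forall>A\<in>set As. a \<notin> A) then 1 else 0)"
  by (induction As arbitrary: X) (auto simp: indicator_def)

lemma mdiff_restrict: "X \<subseteq> Y \<Longrightarrow> mdiff (map ((\<inter>) Y) As) v X = mdiff As v X"
proof (induction As arbitrary: X)
  case (Cons A As)
  have "X \<inter> (Y \<inter> A) = X \<inter> A" "X \<inter> A \<subseteq> Y" using Cons.prems by auto
  with Cons show ?case by simp
qed simp

text \<open>Every summand except \<open>f X\<close> itself involves at least one \<open>A \<in> set As\<close>, so that a base
  point above the union of the sets makes no difference to it.\<close>

lemma mdiff_base:
  assumes "As \<noteq> []" "\<Union>(set As) \<subseteq> X" "X \<subseteq> Y"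
  shows "mdiff As v Y - mdiff As v X = v Y - v X"
  using assms
proof (induction As)
  case (Cons A As)
  have "Y \<inter> A = X \<inter> A" using Cons.prems by auto
  with Cons show ?case by (cases "As = []") auto
qed simp

text \<open>Repeating a set does not change a mixed difference. Inequalities of order \<open>k\<close> thereby imply
  those of all positive orders below \<open>k\<close>.\<close>

lemma mdiff_pad: "mdiff (replicate n A @ A # As) v X = mdiff (A # As) v X"
proof (induction n)
  case (Suc n)
  have "mdiff (replicate n A @ A # As) v (X \<inter> A) = 0"
    by (induction n) (simp_all add: Int_absorb2)
  with Suc show ?case by simp
qed simp

lemma mdiff_eq_sum:
  assumes "distinct js"
  shows "mdiff (map A js) v X =
    (\<Sum>I\<in>Pow (set js). (-1) ^ card I * v (X \<inter> (\<Inter>j\<in>I. A j)))"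
  using assms
proof (induction js arbitrary: X)
  case (Cons j js)
  have inj: "inj_on (insert j) (Pow (set js))"
    using Cons.prems by (auto simp: inj_on_def)
  have disj: "Pow (set js) \<inter> insert j ` Pow (set js) = {}"
    using Cons.prems by auto
  have "(\<Sum>I\<in>insert j ` Pow (set js). (-1) ^ card I * v (X \<inter> (\<Inter>j\<in>I. A j))) =
      (\<Sum>I\<in>Pow (set js). - ((-1) ^ card I * v (X \<inter> A j \<inter> (\<Inter>j\<in>I. A j))))"
    unfolding sum.reindex[OF inj]
  proof (rule sum.cong, goal_cases)
    case (2 I)
    then have "finite I" "j \<notin> I"
      using Cons.prems finite_subset by auto
    then show ?case by (simp add: Int_assoc)
  qed simp
  then show ?case
    using Cons disj
    by (simp add: Pow_insert sum.union_disjoint sum_negf)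
qed simp

section \<open>Totally monotone set functions of finite order\<close>

text \<open>Low orders are included, so that \<open>v\<close> is also non-negative and, if \<open>k \<ge> 1\<close>, monotone on subsets of
  \<open>N\<close>, and the base point is arbitrary. The sets in \<open>As\<close> are unrestricted because only their
  traces on \<open>X\<close> enter.\<close>

definition total_mono :: "nat \<Rightarrow> 'a set \<Rightarrow> ('a set \<Rightarrow> real) \<Rightarrow> bool" where
  "total_mono k N v \<longleftrightarrow> (\<forall>As X. length As \<le> k \<longrightarrow> X \<subseteq> N \<longrightarrow> 0 \<le> mdiff As v X)"

lemma total_monoD: "total_mono k N v \<Longrightarrow> length As \<le> k \<Longrightarrow> X \<subseteq> N \<Longrightarrow> 0 \<le> mdiff As v X"
  by (simp add: total_mono_def)

lemma total_mono_nonneg: "total_mono k N v \<Longrightarrow> X \<subseteq> N \<Longrightarrow> 0 \<le> v X"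
  using total_monoD[of k N v "[]"] by simp

lemma total_mono_mono:
  assumes "total_mono k N v" "1 \<le> k" "Y \<subseteq> X" "X \<subseteq> N"
  shows "v Y \<le> v X"
  using total_monoD[OF assms(1), of "[Y]" X] assms(2-4) by (simp add: Int_absorb1)

lemma k_monotone_sum_eq_mdiff:
  "worth G (\<Union>j\<in>{1..k}. A j) -
      (\<Sum>I\<in>Pow {1..k} - {{}}. (-1) ^ (card I + 1) * worth G (\<Inter>j\<in>I. A j)) =
    mdiff (map A [1..<Suc k]) (worth G) (\<Union>j\<in>{1..k}. A j)"
proof -
  let ?U = "\<Union>j\<in>{1..k}. A j"
  let ?f = "\<lambda>I. (-1) ^ card I * worth G (?U \<inter> (\<Inter>j\<in>I. A j))"
  have set: "set [1..<Suc k] = {1..k}" by auto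
  have "mdiff (map A [1..<Suc k]) (worth G) ?U = (\<Sum>I\<in>Pow {1..k}. ?f I)"
    by (subst mdiff_eq_sum) (simp_all only: set distinct_upt)
  also have "\<dots> = ?f {} + (\<Sum>I\<in>Pow {1..k} - {{}}. ?f I)"
    by (rule sum.remove) auto
  also have "(\<Sum>I\<in>Pow {1..k} - {{}}. ?f I) =
      - (\<Sum>I\<in>Pow {1..k} - {{}}. (-1) ^ (card I + 1) * worth G (\<Inter>j\<in>I. A j))"
    unfolding sum_negf[symmetric]
  proof (rule sum.cong, goal_cases)
    case (2 I)
    then have "(\<Inter>j\<in>I. A j) \<subseteq> ?U" by blast
    then have "?U \<inter> (\<Inter>j\<in>I. A j) = (\<Inter>j\<in>I. A j)" by blast
    then show ?case by simp
  qed simp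
  finally show ?thesis by simp
qed

lemma k_monotone_iff_mdiff:
  "k_monotone k G \<longleftrightarrow>
    (\<forall>As. length As = k \<longrightarrow> \<Union>(set As) \<subseteq> pset G \<longrightarrow> 0 \<le> mdiff As (worth G) (\<Union>(set As)))"
proof -
  have *: "k_monotone k G \<longleftrightarrow> (\<forall>A. (\<forall>j\<in>{1..k}. A j \<subseteq> pset G) \<longrightarrow>
      0 \<le> mdiff (map A [1..<Suc k]) (worth G) (\<Union>(set (map A [1..<Suc k]))))"
    unfolding k_monotone_def k_monotone_sum_eq_mdiff[symmetric]
    by (simp only: set_map set_upt atLeastLessThanSuc_atLeastAtMost k_monotone_sum_eq_mdiff[symmetric] diff_ge_0_iff_ge)
  show ?thesis
  proof
    assume k: "k_monotone k G"
    show "\<forall>As. length As = k \<longrightarrow> \<Union>(set As) \<subseteq> pset G \<longrightarrow> 0 \<le> mdiff As (worth G) (\<Union>(set As))"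
    proof (intro allI impI)
      fix As :: "'a set list" assume As: "length As = k" "\<Union>(set As) \<subseteq> pset G"
      have eq: "map (\<lambda>j. As ! (j - 1)) [1..<Suc k] = As"
        using As(1) by (intro nth_equalityI) (auto simp del: upt_Suc)
      have "\<forall>j\<in>{1..k}. As ! (j - 1) \<subseteq> pset G"
        using As by (force simp: Union_subsetI)
      with k show "0 \<le> mdiff As (worth G) (\<Union>(set As))"
        unfolding * using eq by (metis (no_types, lifting))
    qed
  next
    assume r: "\<forall>As. length As = k \<longrightarrow> \<Union>(set As) \<subseteq> pset G \<longrightarrow> 0 \<le> mdiff As (worth G) (\<Union>(set As))"
    show "k_monotone k G"
      unfolding * by (intro allI impI r[rule_format]) auto
  qed
qed

text \<open>The \<open>k\<close>-monotonicity inequality is a mixed difference of order exactly \<open>k\<close> with base point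
  the union of the sets. Lower orders come from repeating a set; order \<open>2\<close>, applied to \<open>Y\<close> and
  \<open>X - Y\<close>, gives monotonicity by non-negativity; and monotonicity allows larger base points.\<close>

lemma nonneg_k_monotone_iff_total_mono:
  fixes G :: "'a game"
  assumes G: "G \<in> games" and k: "k \<ge> 2"
  shows "nonneg_game G \<and> k_monotone k G \<longleftrightarrow> total_mono k (pset G) (worth G)"
proof
  assume tm: "total_mono k (pset G) (worth G)"
  have "nonneg_game G"
    unfolding nonneg_game_def using total_mono_nonneg[OF tm] by blast
  moreover have "k_monotone k G"
    unfolding k_monotone_iff_mdiff by (intro allI impI total_monoD[OF tm]) simp_all
  ultimately show "nonneg_game G \<and> k_monotone k G" ..
next
  assume asm: "nonneg_game G \<and> k_monotone k G"
  let ?v = "worth G"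
  have union: "0 \<le> mdiff As ?v (\<Union>(set As))"
    if As: "As \<noteq> []" "length As \<le> k" "\<Union>(set As) \<subseteq> pset G" for As
  proof -
    obtain A Bs where AB: "As = A # Bs" using As(1) by (cases As) auto
    let ?Cs = "replicate (k - length As) A @ As"
    have "\<Union>(set ?Cs) = \<Union>(set As)" using AB by (auto simp: set_replicate_conv_if split: if_splits)
    then show ?thesis
      using asm As mdiff_pad[of "k - length As" A Bs ?v "\<Union>(set As)"]
      unfolding k_monotone_iff_mdiff AB
      by (metis AB le_add_diff_inverse2 length_append length_replicate)
  qed
  have mono: "?v Y \<le> ?v X" if XY: "Y \<subseteq> X" "X \<subseteq> pset G" for X Y
  proof -
    have "Y \<union> (X - Y) = X" using XY by auto
    then have "0 \<le> ?v X - ?v (X - Y) - (?v Y - ?v {})"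
      using union[of "[Y, X - Y]"] k XY
      by (simp add: Int_absorb1 Int_absorb2 Un_commute)
    moreover have "0 \<le> ?v (X - Y)" "?v {} = 0"
      using asm XY(2) G nonneg_gameD[of G "X - Y"] by (auto simp: games_def)
    ultimately show ?thesis by simp
  qed
  show "total_mono k (pset G) ?v"
    unfolding total_mono_def
  proof (intro allI impI)
    fix As :: "'a set list" and X assume len: "length As \<le> k" and X: "X \<subseteq> pset G"
    show "0 \<le> mdiff As ?v X"
    proof (cases "As = []")
      case True
      then show ?thesis using asm X by (simp add: nonneg_game_def)
    next
      case False
      let ?Bs = "map ((\<inter>) X) As" and ?U = "\<Union>(set (map ((\<inter>) X) As))"
      have U: "?U \<subseteq> X" by auto
      have "mdiff As ?v X = mdiff ?Bs ?v X" by (simp add: mdiff_restrict)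
      also have "\<dots> = mdiff ?Bs ?v ?U + (?v X - ?v ?U)"
        using mdiff_base[of ?Bs ?U X ?v] False U by simp
      finally show ?thesis
        using union[of ?Bs] mono[OF U X] False len subset_trans[OF U X] by simp
    qed
  qed
qed

text \<open>A Leibniz rule for inequalities. Replacing \<open>S\<close> by \<open>S \<inter> C\<close> in both arguments of \<open>F\<close> can be
  done in the first argument and then in the second, so that a difference of the diagonal is the
  sum of two differences in one argument each. The bounding sets \<open>X0\<close> and \<open>Y0\<close> make room for the
  induction: in the second of these differences, the first argument has already shrunk to
  \<open>S \<inter> C\<close>.\<close>

lemma mdiff_two_arg_nonneg:
  fixes F :: "'a set \<Rightarrow> 'a set \<Rightarrow> real"
  assumes "length Cs = m" "X0 \<subseteq> P" "Y0 \<subseteq> Q"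
    and "\<And>As Bs X Y. length As + length Bs = m \<Longrightarrow> X \<subseteq> P \<Longrightarrow> Y \<subseteq> Q \<Longrightarrow>
      0 \<le> mdiff As (\<lambda>X. mdiff Bs (F X) Y) X"
  shows "0 \<le> mdiff Cs (\<lambda>S. F (S \<inter> X0) (S \<inter> Y0)) S"
  using assms
proof (induction Cs arbitrary: m F X0 Y0)
  case Nil
  have "S \<inter> X0 \<subseteq> P" "S \<inter> Y0 \<subseteq> Q" using Nil.prems by auto
  then show ?case using Nil.prems(1) Nil.prems(4)[of "[]" "[]"] by simp
next
  case (Cons C Cs)
  let ?F1 = "\<lambda>X Y. F X Y - F (X \<inter> C) Y"
  let ?F2 = "\<lambda>X Y. F X Y - F X (Y \<inter> C)"
  have "0 \<le> mdiff Cs (\<lambda>S. ?F1 (S \<inter> X0) (S \<inter> Y0)) S"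
  proof (rule Cons.IH[of "length Cs"])
    fix As :: "'a set list" and Bs :: "'a set list" and X Y
    assume *: "length As + length Bs = length Cs" "X \<subseteq> P" "Y \<subseteq> Q"
    have "mdiff As (\<lambda>X. mdiff Bs (?F1 X) Y) X =
        mdiff As (\<lambda>X. mdiff Bs (F X) Y - mdiff Bs (F (X \<inter> C)) Y) X"
      using mdiff_linear[of Bs 1 _ "-1"] by simp
    also have "\<dots> = mdiff (C # As) (\<lambda>X. mdiff Bs (F X) Y) X"
      by (rule mdiff_diff)
    also have "\<dots> \<ge> 0" using * Cons.prems(1) by (intro Cons.prems(4)) auto
    finally show "0 \<le> mdiff As (\<lambda>X. mdiff Bs (?F1 X) Y) X" .
  qed (use Cons.prems in auto)
  moreover have "0 \<le> mdiff Cs (\<lambda>S. ?F2 (S \<inter> (X0 \<inter> C)) (S \<inter> Y0)) S"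
  proof (rule Cons.IH[of "length Cs"])
    fix As :: "'a set list" and Bs :: "'a set list" and X Y
    assume *: "length As + length Bs = length Cs" "X \<subseteq> P" "Y \<subseteq> Q"
    have "mdiff As (\<lambda>X. mdiff Bs (?F2 X) Y) X = mdiff As (\<lambda>X. mdiff (C # Bs) (F X) Y) X"
      by (simp only: mdiff_diff)
    also have "\<dots> \<ge> 0" using * Cons.prems(1) by (intro Cons.prems(4)) auto
    finally show "0 \<le> mdiff As (\<lambda>X. mdiff Bs (?F2 X) Y) X" .
  qed (use Cons.prems in auto)
  moreover have "mdiff (C # Cs) (\<lambda>S. F (S \<inter> X0) (S \<inter> Y0)) S =
      mdiff Cs (\<lambda>S. 1 * ?F1 (S \<inter> X0) (S \<inter> Y0) + 1 * ?F2 (S \<inter> (X0 \<inter> C)) (S \<inter> Y0)) S"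
    unfolding mdiff_diff[symmetric] by (simp add: Int_ac)
  ultimately show ?case unfolding mdiff_linear by simp
qed

lemma (in composable) total_mono_comp:
  assumes a: "total_mono k (pset G) (worth G)" and b: "total_mono k (pset H) (worth H)"
    and k: "1 \<le> k"
  shows "total_mono k (pset (game_comp G i H)) (worth (game_comp G i H))"
  unfolding total_mono_def
proof (intro allI impI)
  fix Cs :: "'a set list" and S assume len: "length Cs \<le> k" and S: "S \<subseteq> pset (game_comp G i H)"
  let ?P = "pset G - {i}" and ?Q = "pset H"
  let ?\<alpha> = "worth G" and ?\<beta> = "worth H"
  let ?F = "\<lambda>X Y. (?\<beta> ?Q - ?\<beta> Y) * ?\<alpha> X + ?\<beta> Y * ?\<alpha> (insert i X)"
  have "0 \<le> mdiff Cs (\<lambda>S. ?F (S \<inter> ?P) (S \<inter> ?Q)) S"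
  proof (rule mdiff_two_arg_nonneg[of Cs "length Cs" ?P ?P ?Q ?Q])
    fix As Bs :: "'a set list" and X Y
    assume *: "length As + length Bs = length Cs" "X \<subseteq> ?P" "Y \<subseteq> ?Q"
    have Xi: "insert i X \<subseteq> pset G" "i \<notin> X" "X \<subseteq> pset G" using * i by auto
    have with_i: "mdiff As (\<lambda>X. ?\<alpha> (insert i X)) X = mdiff (map (insert i) As) ?\<alpha> (insert i X)"
      by (rule mdiff_insert_arg)
    show "0 \<le> mdiff As (\<lambda>X. mdiff Bs (?F X) Y) X"
    proof (cases "Bs = []")
      case True
      have "0 \<le> mdiff As ?\<alpha> X" "0 \<le> mdiff As (\<lambda>X. ?\<alpha> (insert i X)) X"
        unfolding with_i using a Xi * len True by (auto intro!: total_monoD[OF a])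
      moreover have "0 \<le> ?\<beta> Y" "?\<beta> Y \<le> ?\<beta> ?Q"
        using total_mono_nonneg[OF b] total_mono_mono[OF b k] * by auto
      ultimately show ?thesis
        using True by (simp add: mdiff_linear)
    next
      case False
      have inner: "mdiff Bs (?F X) Y = mdiff Bs ?\<beta> Y * ?\<alpha> (insert i X) + (- mdiff Bs ?\<beta> Y) * ?\<alpha> X" for X
      proof -
        have "?F X = (\<lambda>Y. ?\<beta> ?Q * ?\<alpha> X * 1 + (?\<alpha> (insert i X) - ?\<alpha> X) * ?\<beta> Y)"
          by (simp add: algebra_simps)
        then have "mdiff Bs (?F X) Y = (?\<alpha> (insert i X) - ?\<alpha> X) * mdiff Bs ?\<beta> Y"
          using False mdiff_linear[of Bs "?\<beta> ?Q * ?\<alpha> X" "\<lambda>_. 1" "?\<alpha> (insert i X) - ?\<alpha> X" ?\<beta> Y]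
          by (simp add: mdiff_const)
        then show ?thesis by (simp add: algebra_simps)
      qed
      \<comment> \<open>The difference in the player \<open>i\<close> is the one for the set \<open>- {i}\<close> at the base point
        \<open>insert i X\<close>. It takes the place of a difference in the second argument, so that the
        order in the outer game does not exceed \<open>k\<close>.\<close>
      have drop: "insert i X \<inter> - {i} = X" using Xi by auto
      have "mdiff As (\<lambda>X. mdiff Bs (?F X) Y) X =
          mdiff Bs ?\<beta> Y * (mdiff As (\<lambda>X. ?\<alpha> (insert i X)) X - mdiff As ?\<alpha> X)"
        unfolding inner mdiff_linear by (simp add: algebra_simps)
      also have "mdiff As (\<lambda>X. ?\<alpha> (insert i X)) X - mdiff As ?\<alpha> X =
          mdiff ((- {i}) # map (insert i) As) ?\<alpha> (insert i X)"
        by (simp add: with_i drop mdiff_insert_irrelevant Xi)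
      also have "mdiff Bs ?\<beta> Y * \<dots> \<ge> 0"
        using False * len Xi
        by (intro mult_nonneg_nonneg total_monoD[OF a] total_monoD[OF b]) (cases Bs; auto)+
      finally show ?thesis .
    qed
  qed auto
  also have "\<dots> = mdiff Cs (worth (game_comp G i H)) S"
    using S by (intro mdiff_cong) (auto simp: worth_comp)
  finally show "0 \<le> mdiff Cs (worth (game_comp G i H)) S" .
qed

lemma total_mono_perm_game:
  fixes G :: "'a game"
  assumes \<sigma>: "\<sigma> permutes pset G" and G: "total_mono k (pset G) (worth G)"
  shows "total_mono k (pset (perm_game \<sigma> G)) (worth (perm_game \<sigma> G))"
  unfolding total_mono_def
proof (intro allI impI)
  fix As :: "'a set list" and X assume len: "length As \<le> k" and X: "X \<subseteq> pset (perm_game \<sigma> G)"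
  have "mdiff As (worth (perm_game \<sigma> G)) X = mdiff As (\<lambda>S. worth G (inv \<sigma> ` S)) X"
    using X by (intro mdiff_cong) auto
  also have "\<dots> = mdiff (map ((`) (inv \<sigma>)) As) (worth G) (inv \<sigma> ` X)"
    by (rule mdiff_image) (rule permutes_inj[OF permutes_inv[OF \<sigma>]])
  also have "\<dots> \<ge> 0"
    using len X inv_permutes_image_subset[OF \<sigma>] by (intro total_monoD[OF G]) auto
  finally show "0 \<le> mdiff As (worth (perm_game \<sigma> G)) X" .
qed

lemma total_mono_unit_game: "total_mono k (pset (unit_game a)) (worth (unit_game a))"
  unfolding total_mono_def
proof (intro allI impI)
  fix As :: "'a set list" and X assume X: "X \<subseteq> pset (unit_game a)"
  have "mdiff As (worth (unit_game a)) X = mdiff As (\<lambda>S. indicator S a) X"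
    using X by (intro mdiff_cong) auto
  then show "0 \<le> mdiff As (worth (unit_game a)) X" by (simp add: mdiff_indicator)
qed

lemma suboperad_k_monotone:
  assumes "k \<ge> 2"
  shows "suboperad {G \<in> (games :: 'a game set). nonneg_game G \<and> k_monotone k G}"
proof -
  have "suboperad {G \<in> (games :: 'a game set). total_mono k (pset G) (worth G)}"
    using assms by (intro suboperadI total_mono_unit_game total_mono_perm_game
        composable.total_mono_comp) auto
  moreover have "{G \<in> (games :: 'a game set). total_mono k (pset G) (worth G)} =
      {G \<in> (games :: 'a game set). nonneg_game G \<and> k_monotone k G}"
    using nonneg_k_monotone_iff_total_mono[OF _ assms] by auto
  ultimately show ?thesis by simp
qed

section \<open>Duality between monotone and alternating games\<close>

definition dual_game :: "'a game \<Rightarrow> 'a game" where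
  "dual_game G = \<lparr>players = players G,
     worth = (\<lambda>S\<in>Pow (pset G). worth G (pset G) - worth G (pset G - S))\<rparr>"

lemma dual_game_simps [simp]:
  "players (dual_game G) = players G"
  "S \<subseteq> pset G \<Longrightarrow> worth (dual_game G) S = worth G (pset G) - worth G (pset G - S)"
  by (auto simp: dual_game_def)

lemma dual_game_in_games: "G \<in> games \<Longrightarrow> dual_game G \<in> games"
  by (simp add: games_def) (simp add: dual_game_def)

lemma game_eqI:
  assumes "G \<in> games" "H \<in> games" "players G = players H"
    and "\<And>S. S \<subseteq> pset G \<Longrightarrow> worth G S = worth H S"
  shows "G = H"
proof (rule game.equality)
  show "worth G = worth H"
    using assms by (intro extensionalityI[of _ "Pow (pset G)"]) (auto simp: games_def)
qed (use assms in simp_all)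

lemma dual_dual_game: "G \<in> games \<Longrightarrow> dual_game (dual_game G) = G"
proof (rule game_eqI)
  assume G: "G \<in> games"
  then show "worth (dual_game (dual_game G)) S = worth G S" if "S \<subseteq> pset (dual_game (dual_game G))" for S
    using that by (simp add: games_def double_diff)
qed (simp_all add: dual_game_in_games)

lemma dual_unit_game: "dual_game (unit_game a) = unit_game a"
  by (rule game_eqI) (auto simp: dual_game_in_games unit_game_in_games indicator_def)

lemma dual_perm_game:
  assumes "G \<in> games" "\<sigma> permutes pset G"
  shows "dual_game (perm_game \<sigma> G) = perm_game \<sigma> (dual_game G)"
proof (rule game_eqI)
  fix S assume S: "S \<subseteq> pset (dual_game (perm_game \<sigma> G))"
  have "inv \<sigma> ` pset G = pset G"
    by (rule permutes_image[OF permutes_inv[OF assms(2)]])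
  moreover have "inv \<sigma> ` (pset G - S) = inv \<sigma> ` pset G - inv \<sigma> ` S"
    by (rule image_set_diff[OF permutes_inj[OF permutes_inv[OF assms(2)]]])
  ultimately show "worth (dual_game (perm_game \<sigma> G)) S = worth (perm_game \<sigma> (dual_game G)) S"
    using S inv_permutes_image_subset[OF assms(2), of S] by simp
qed (simp_all add: assms dual_game_in_games perm_game_in_games)

lemma (in composable) dual_composable: "composable (dual_game G) i (dual_game H)"
  using G H disjoint i by (simp add: composable_def dual_game_in_games)

text \<open>Passing to complements sends \<open>S\<^sub>A\<close> to \<open>A - (S\<^sub>A \<union> {i})\<close> and \<open>S\<^sub>A \<union> {i}\<close> to \<open>A - S\<^sub>A\<close>, and it sends
  the weight \<open>\<beta>(S\<^sub>B)\<close> to its complement in \<open>\<beta>(B)\<close>. The two terms of the composite are thus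
  exchanged together with their weights.\<close>

lemma (in composable) dual_comp:
  "dual_game (game_comp G i H) = game_comp (dual_game G) i (dual_game H)"
proof (rule game_eqI)
  interpret D: composable "dual_game G" i "dual_game H" by (rule dual_composable)
  show "dual_game (game_comp G i H) \<in> games" "game_comp (dual_game G) i (dual_game H) \<in> games"
    by (simp_all add: dual_game_in_games comp_in_games D.comp_in_games)
  show "players (dual_game (game_comp G i H)) = players (game_comp (dual_game G) i (dual_game H))"
    by (simp add: game_comp_def Let_def)
  fix S assume "S \<subseteq> pset (dual_game (game_comp G i H))"
  then have S: "S \<subseteq> pset (game_comp G i H)" by simp
  then have S': "S \<subseteq> pset (game_comp (dual_game G) i (dual_game H))"
    by (simp add: pset_comp D.pset_comp)
  let ?N = "pset (game_comp G i H)" and ?P = "pset G - {i}"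
  have "(?N - S) \<inter> pset H = pset H - S \<inter> pset H"
    "(?N - S) \<inter> ?P = pset G - insert i (S \<inter> ?P)"
    "insert i (pset G - insert i (S \<inter> ?P)) = pset G - S \<inter> ?P"
    using disjoint i by (auto simp: pset_comp)
  moreover have "worth H {} = 0" using H by (simp add: games_def)
  ultimately show "worth (dual_game (game_comp G i H)) S =
      worth (game_comp (dual_game G) i (dual_game H)) S"
    using S i outer_subset by (simp add: D.worth_comp[OF S'] comp_grand_worth worth_comp)
      (simp add: algebra_simps)
qed

lemma suboperad_dual_preimage:
  assumes "suboperad \<C>"
  shows "suboperad {G \<in> games. dual_game G \<in> \<C>}"
proof (rule suboperadI)
  fix G i and H :: "'a game"
  assume c: "composable G i H" and GH: "dual_game G \<in> \<C>" "dual_game H \<in> \<C>"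
  then show "dual_game (game_comp G i H) \<in> \<C>"
    using assms composable.dual_composable[OF c]
    unfolding composable.dual_comp[OF c] suboperad_def composable_def by blast
qed (use assms in \<open>simp_all add: suboperad_def dual_unit_game dual_perm_game\<close>)

lemma dual_capacity:
  assumes "nonneg_game G \<and> monotone_game G"
  shows "nonneg_game (dual_game G) \<and> monotone_game (dual_game G)"
  using assms by (auto simp: nonneg_game_def monotone_game_def Diff_mono)

text \<open>This is the inclusion-exclusion formula for a constant function, with a vanishing mixed
  difference.\<close>

lemma sum_inclusion_exclusion_signs:
  fixes k :: nat
  assumes "k \<ge> 1"
  shows "(\<Sum>I\<in>Pow {1..k} - {{}}. (-1) ^ (card I + 1) :: real) = 1"
proof -
  let ?f = "\<lambda>I :: nat set. (-1 :: real) ^ card I"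
  have set: "set [1..<Suc k] = {1..k}" by auto
  have "(\<Sum>I\<in>Pow {1..k}. ?f I) = mdiff (map (\<lambda>_. {}) [1..<Suc k]) (\<lambda>_ :: nat set. 1) {}"
    by (subst mdiff_eq_sum) (simp_all only: set distinct_upt mult_1_right)
  then have "(\<Sum>I\<in>Pow {1..k}. ?f I) = 0"
    using assms by (simp add: mdiff_const)
  moreover have "(\<Sum>I\<in>Pow {1..k}. ?f I) = ?f {} + (\<Sum>I\<in>Pow {1..k} - {{}}. ?f I)"
    by (rule sum.remove) auto
  ultimately show ?thesis by (simp add: sum_negf)
qed

text \<open>Complements exchange unions and intersections, and the constant \<open>v(N)\<close> in the dual game
  cancels because the signs add up to \<open>1\<close>.\<close>

lemma k_monotone_dual_iff:
  assumes "k \<ge> 1"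
  shows "k_monotone k (dual_game G) \<longleftrightarrow> k_alternating k G"
proof -
  let ?N = "pset G"
  let ?mono = "\<lambda>A. worth (dual_game G) (\<Union>j\<in>{1..k}. A j) \<ge>
      (\<Sum>I\<in>Pow {1..k} - {{}}. (-1) ^ (card I + 1) * worth (dual_game G) (\<Inter>j\<in>I. A j))"
  let ?alt = "\<lambda>A. worth G (\<Inter>j\<in>{1..k}. A j) \<le>
      (\<Sum>I\<in>Pow {1..k} - {{}}. (-1) ^ (card I + 1) * worth G (\<Union>j\<in>I. A j))"
  have dual: "?mono A \<longleftrightarrow> ?alt (\<lambda>j. ?N - A j)" if A: "\<forall>j\<in>{1..k}. A j \<subseteq> ?N" for A
  proof -
    have "(\<Sum>I\<in>Pow {1..k} - {{}}. (-1) ^ (card I + 1) * worth (dual_game G) (\<Inter>j\<in>I. A j)) =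
        (\<Sum>I\<in>Pow {1..k} - {{}}. (-1) ^ (card I + 1) * worth G ?N -
            (-1) ^ (card I + 1) * worth G (\<Union>j\<in>I. ?N - A j))"
    proof (rule sum.cong, goal_cases)
      case (2 I)
      then have "(\<Inter>j\<in>I. A j) \<subseteq> ?N" "?N - (\<Inter>j\<in>I. A j) = (\<Union>j\<in>I. ?N - A j)"
        using A by blast+
      then show ?case by (simp add: algebra_simps)
    qed simp
    also have "\<dots> = worth G ?N -
        (\<Sum>I\<in>Pow {1..k} - {{}}. (-1) ^ (card I + 1) * worth G (\<Union>j\<in>I. ?N - A j))"
      unfolding sum_subtractf sum_distrib_right[symmetric]
        sum_inclusion_exclusion_signs[OF assms] by simp
    finally have "(\<Sum>I\<in>Pow {1..k} - {{}}. (-1) ^ (card I + 1) * worth (dual_game G) (\<Inter>j\<in>I. A j)) =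
      worth G ?N - (\<Sum>I\<in>Pow {1..k} - {{}}. (-1) ^ (card I + 1) * worth G (\<Union>j\<in>I. ?N - A j))" .
    moreover have "(\<Union>j\<in>{1..k}. A j) \<subseteq> ?N"
      "?N - (\<Union>j\<in>{1..k}. A j) = (\<Inter>j\<in>{1..k}. ?N - A j)"
      using A assms by auto
    ultimately show ?thesis by simp
  qed
  have compl: "?alt (\<lambda>j. ?N - (?N - A j)) \<longleftrightarrow> ?alt A" if A: "\<forall>j\<in>{1..k}. A j \<subseteq> ?N" for A
  proof -
    have eq: "?N - (?N - A j) = A j" if "j \<in> {1..k}" for j
      using A that by blast
    have "(\<Inter>j\<in>{1..k}. ?N - (?N - A j)) = (\<Inter>j\<in>{1..k}. A j)"
      by (rule INF_cong) (simp_all only: eq)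
    moreover have "(\<Sum>I\<in>Pow {1..k} - {{}}. (-1) ^ (card I + 1) * worth G (\<Union>j\<in>I. ?N - (?N - A j))) =
       (\<Sum>I\<in>Pow {1..k} - {{}}. (-1) ^ (card I + 1) * worth G (\<Union>j\<in>I. A j))"
    proof (rule sum.cong, goal_cases)
      case (2 I)
      then have "I \<subseteq> {1..k}" by simp
      then have "(\<Union>j\<in>I. ?N - (?N - A j)) = (\<Union>j\<in>I. A j)"
        by (intro SUP_cong[OF refl] eq) (rule subsetD)
      then show ?case by simp
    qed simp
    ultimately show ?thesis by simp
  qed
  show ?thesis
  proof
    assume alternating: "k_alternating k G"
    have alt: "?alt A" if "\<forall>j\<in>{1..k}. A j \<subseteq> ?N" for A
      by (rule alternating[unfolded k_alternating_def, THEN spec, THEN mp, OF that])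
    have "?mono A" if "\<forall>j\<in>{1..k}. A j \<subseteq> ?N" for A
      unfolding dual[OF that] by (rule alt) auto
    then show "k_monotone k (dual_game G)"
      unfolding k_monotone_def dual_game_simps(1) by (intro allI impI)
  next
    assume monotone: "k_monotone k (dual_game G)"
    have mono: "?mono A" if "\<forall>j\<in>{1..k}. A j \<subseteq> ?N" for A
      by (rule monotone[unfolded k_monotone_def dual_game_simps(1), THEN spec, THEN mp, OF that])
    have "?alt A" if A: "\<forall>j\<in>{1..k}. A j \<subseteq> ?N" for A
    proof -
      have sub: "\<forall>j\<in>{1..k}. ?N - A j \<subseteq> ?N" by auto
      show ?thesis using mono[OF sub] unfolding dual[OF sub] compl[OF A] .
    qed
    then show "k_alternating k G" unfolding k_alternating_def by (intro allI impI)
  qed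
qed

lemma nonneg_k_monotone_imp_monotone:
  assumes "G \<in> games" "k \<ge> 2" "nonneg_game G \<and> k_monotone k G"
  shows "monotone_game G"
proof -
  have "total_mono k (pset G) (worth G)"
    using assms nonneg_k_monotone_iff_total_mono by blast
  then show ?thesis
    unfolding monotone_game_def using assms(2) total_mono_mono[of k "pset G" "worth G"] by simp
qed

text \<open>Non-negative \<open>k\<close>-monotone games are monotone, hence capacities, and duality preserves
  capacities.\<close>

lemma k_alternating_capacity_iff_dual:
  assumes "G \<in> games" "k \<ge> 2"
  shows "nonneg_game G \<and> monotone_game G \<and> k_alternating k G \<longleftrightarrow>
    nonneg_game (dual_game G) \<and> k_monotone k (dual_game G)"
proof -
  have alternating: "k_monotone k (dual_game G) \<longleftrightarrow> k_alternating k G"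
    using assms(2) by (intro k_monotone_dual_iff) simp
  show ?thesis
  proof
    assume "nonneg_game G \<and> monotone_game G \<and> k_alternating k G"
    then show "nonneg_game (dual_game G) \<and> k_monotone k (dual_game G)"
      using dual_capacity[of G] alternating by simp
  next
    assume dual: "nonneg_game (dual_game G) \<and> k_monotone k (dual_game G)"
    then have "monotone_game (dual_game G)"
      by (rule nonneg_k_monotone_imp_monotone[OF dual_game_in_games[OF assms(1)] assms(2)])
    then have "nonneg_game G \<and> monotone_game G"
      using dual dual_capacity[of "dual_game G"] by (simp add: dual_dual_game[OF assms(1)])
    then show "nonneg_game G \<and> monotone_game G \<and> k_alternating k G"
      using dual alternating by simp
  qed
qed

lemma suboperad_k_alternating:
  assumes "k \<ge> 2"
  shows "suboperad {G \<in> (games :: 'a game set). nonneg_game G \<and> monotone_game G \<and> k_alternating k G}"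
proof -
  have "{G \<in> (games :: 'a game set). nonneg_game G \<and> monotone_game G \<and> k_alternating k G} =
      {G \<in> (games :: 'a game set). dual_game G \<in> {G \<in> (games :: 'a game set). nonneg_game G \<and> k_monotone k G}}"
    by (intro Collect_cong conj_cong refl)
      (simp add: dual_game_in_games k_alternating_capacity_iff_dual[OF _ assms])
  then show ?thesis
    by (simp only: suboperad_dual_preimage[OF suboperad_k_monotone[OF assms]])
qed

section \<open>The orders two and infinity\<close>

lemma Pow_1_2_nonempty: "Pow {1..2::nat} - {{}} = {{1}, {2}, {1, 2}}"
proof -
  have "{1..2::nat} = {1, 2}" by auto
  then have "Pow {1..2::nat} = insert {} {{1}, {2}, {1, 2}}"
    by (simp add: Pow_insert insert_commute)
  then show ?thesis by (simp add: insert_Diff_if)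
qed

lemma two_monotone_iff_convex: "k_monotone 2 G \<longleftrightarrow> convex_game G"
proof -
  have 12: "{1..2::nat} = {1, 2}" by auto
  have "k_monotone 2 G \<longleftrightarrow> (\<forall>A :: nat \<Rightarrow> 'a set. A 1 \<subseteq> pset G \<and> A 2 \<subseteq> pset G \<longrightarrow>
      worth G (A 1) + worth G (A 2) \<le> worth G (A 1 \<union> A 2) + worth G (A 1 \<inter> A 2))"
    unfolding k_monotone_def Pow_1_2_nonempty unfolding 12 by (simp add: algebra_simps)
  also have "\<dots> \<longleftrightarrow> convex_game G"
    unfolding convex_game_def
  proof (safe, goal_cases)
    case (1 S T)
    from 1(1)[rule_format, of "\<lambda>j. if j = 1 then S else T"] 1(2,3) show ?case by simp
  qed auto
  finally show ?thesis .
qed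

lemma two_alternating_iff_submodular: "k_alternating 2 G \<longleftrightarrow> submodular_game G"
proof -
  have 12: "{1..2::nat} = {1, 2}" by auto
  have "k_alternating 2 G \<longleftrightarrow> (\<forall>A :: nat \<Rightarrow> 'a set. A 1 \<subseteq> pset G \<and> A 2 \<subseteq> pset G \<longrightarrow>
      worth G (A 1) + worth G (A 2) \<ge> worth G (A 1 \<union> A 2) + worth G (A 1 \<inter> A 2))"
    unfolding k_alternating_def Pow_1_2_nonempty unfolding 12 by (simp add: algebra_simps)
  also have "\<dots> \<longleftrightarrow> submodular_game G"
    unfolding submodular_game_def
  proof (safe, goal_cases)
    case (1 S T)
    from 1(1)[rule_format, of "\<lambda>j. if j = 1 then S else T"] 1(2,3) show ?case by simp
  qed auto
  finally show ?thesis .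
qed

lemma suboperad_INT:
  assumes "\<And>k. k \<in> K \<Longrightarrow> suboperad (\<C> k)" "K \<noteq> {}"
  shows "suboperad (\<Inter>k\<in>K. \<C> k)"
proof -
  obtain k0 where k0: "k0 \<in> K" using assms(2) by blast
  show ?thesis
    unfolding suboperad_def
  proof (intro conjI allI ballI impI INT_I)
    show "(\<Inter>k\<in>K. \<C> k) \<subseteq> games"
      using assms(1)[OF k0] k0 by (auto simp: suboperad_def)
  next
    fix a k assume "k \<in> K"
    then show "unit_game a \<in> \<C> k" using assms(1)[of k] by (simp add: suboperad_def)
  next
    fix G \<sigma> k assume "G \<in> (\<Inter>k\<in>K. \<C> k)" "\<sigma> permutes pset G" "k \<in> K"
    then show "perm_game \<sigma> G \<in> \<C> k" using assms(1)[of k] by (simp add: suboperad_def)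
  next
    fix G i H k
    assume "G \<in> (\<Inter>k\<in>K. \<C> k)" "H \<in> (\<Inter>k\<in>K. \<C> k)" "pset G \<inter> pset H = {}"
      "i \<in> pset G" "k \<in> K"
    then show "game_comp G i H \<in> \<C> k" using assms(1)[of k] by (simp add: suboperad_def)
  qed
qed

lemma suboperad_all_orders:
  fixes P :: "nat \<Rightarrow> 'a game \<Rightarrow> bool"
  assumes "\<And>k. k \<ge> 2 \<Longrightarrow> suboperad {G \<in> games. Q G \<and> P k G}"
  shows "suboperad {G \<in> games. Q G \<and> (\<forall>k\<ge>2. P k G)}"
proof -
  have "{G \<in> games. Q G \<and> (\<forall>k\<ge>2. P k G)} = (\<Inter>k\<in>{2..}. {G \<in> games. Q G \<and> P k G})"
    by auto
  then show ?thesis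
    using suboperad_INT[of "{2..}" "\<lambda>k. {G \<in> games. Q G \<and> P k G}"] assms by simp
qed

section \<open>Balanced games\<close>

text \<open>Balancing weights live on sets of coalitions. In applications the same coalition arises
  from several indices, possibly with weight \<open>0\<close>, or is empty; merging equal coalitions and
  dropping those of weight \<open>0\<close> and the empty one reduces such a family to a balanced collection.\<close>

lemma balanced_family_bound:
  assumes G: "G \<in> games" "balanced_game G" and K: "finite K"
    and w: "\<And>k. k \<in> K \<Longrightarrow> 0 \<le> w k" and S: "\<And>k. k \<in> K \<Longrightarrow> S k \<subseteq> pset G"
    and cover: "\<And>p. p \<in> pset G \<Longrightarrow> (\<Sum>k\<in>K. w k * indicator (S k) p) = 1"
  shows "(\<Sum>k\<in>K. w k * worth G (S k)) \<le> worth G (pset G)"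
proof -
  let ?N = "pset G"
  define l where "l T = (\<Sum>k\<in>{k \<in> K. S k = T}. w k)" for T
  define \<B> where "\<B> = {T \<in> Pow ?N. T \<noteq> {} \<and> l T > 0}"
  have l_nonneg: "0 \<le> l T" for T
    unfolding l_def using w by (auto intro: sum_nonneg)
  have group: "(\<Sum>T\<in>\<B>. l T * f T) = (\<Sum>k\<in>K. w k * f (S k))" if "f {} = 0" for f :: "'a set \<Rightarrow> real"
  proof -
    have "(\<Sum>T\<in>\<B>. l T * f T) = (\<Sum>T\<in>Pow ?N. l T * f T)"
    proof (rule sum.mono_neutral_left)
      show "\<forall>T\<in>Pow ?N - \<B>. l T * f T = 0"
        using l_nonneg that by (force simp: \<B>_def not_less intro: antisym)
    qed (auto simp: \<B>_def)
    also have "\<dots> = (\<Sum>T\<in>Pow ?N. \<Sum>k\<in>{k \<in> K. S k = T}. w k * f (S k))"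
      by (simp add: l_def sum_distrib_right)
    also have "\<dots> = (\<Sum>k\<in>K. w k * f (S k))"
      using K S by (intro sum.group) auto
    finally show ?thesis .
  qed
  have weight: "(\<Sum>T\<in>\<B>. l T * indicator T p) = 1" if "p \<in> ?N" for p
    using group[of "\<lambda>T. indicator T p"] cover[OF that] by simp
  have "l T \<le> 1" if T: "T \<in> \<B>" for T
  proof -
    obtain p where p: "p \<in> T" "p \<in> ?N" using T by (auto simp: \<B>_def)
    have "l T * indicator T p \<le> (\<Sum>T\<in>\<B>. l T * indicator T p)"
      using T l_nonneg by (intro member_le_sum) (auto simp: \<B>_def)
    then show ?thesis using weight p by simp
  qed
  then have "balancing_weights ?N \<B> l"
    using weight by (auto simp: balancing_weights_def \<B>_def)
  then have "(\<Sum>T\<in>\<B>. l T * worth G T) \<le> worth G ?N"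
    using G by (simp add: balanced_game_def)
  then show ?thesis using group[of "worth G"] G by (simp add: games_def)
qed

text \<open>Players that are covered with total weight less than \<open>c\<close> can be filled up by their
  singletons, which costs nothing in a non-negative game; dividing by \<open>c\<close> then gives a balanced
  family. For \<open>c = 0\<close>, only the empty coalition can have a non-zero weight.\<close>

lemma balanced_packing_bound:
  assumes G: "G \<in> games" "nonneg_game G" "balanced_game G" and K: "finite K"
    and w: "\<And>k. k \<in> K \<Longrightarrow> 0 \<le> w k" and S: "\<And>k. k \<in> K \<Longrightarrow> S k \<subseteq> pset G"
    and cover: "\<And>p. p \<in> pset G \<Longrightarrow> (\<Sum>k\<in>K. w k * indicator (S k) p) \<le> c"
  shows "(\<Sum>k\<in>K. w k * worth G (S k)) \<le> c * worth G (pset G)"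
proof -
  let ?N = "pset G"
  let ?cov = "\<lambda>p. \<Sum>k\<in>K. w k * indicator (S k) p"
  have cov_nonneg: "0 \<le> ?cov p" for p
    using w by (intro sum_nonneg) auto
  obtain q where q: "q \<in> ?N" using G(1) by (cases "players G") (auto simp: games_def)
  have "0 \<le> c" using cover[OF q] cov_nonneg[of q] by linarith
  then consider "c = 0" | "c > 0" by linarith
  then show ?thesis
  proof cases
    case 1
    have "w k * worth G (S k) = 0" if k: "k \<in> K" for k
    proof (cases "S k = {}")
      case True
      then show ?thesis using G(1) by (simp add: games_def)
    next
      case False
      then obtain p where p: "p \<in> S k" by auto
      have "w k * indicator (S k) p \<le> ?cov p"
        using k K w by (intro member_le_sum) auto
      then have "w k = 0" using p cover[of p] S[OF k] w[OF k] 1 by auto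
      then show ?thesis by simp
    qed
    then show ?thesis using 1 sum.neutral[of K "\<lambda>k. w k * worth G (S k)"] by simp
  next
    case 2
    let ?w = "case_sum (\<lambda>k. w k / c) (\<lambda>p. 1 - ?cov p / c)"
    let ?S = "case_sum S (\<lambda>p. {p})"
    have slack: "0 \<le> 1 - ?cov p / c" if "p \<in> ?N" for p
      using cover[OF that] 2 by (simp add: pos_divide_le_eq)
    have "(\<Sum>x\<in>K <+> ?N. ?w x * worth G (?S x)) \<le> worth G ?N"
    proof (rule balanced_family_bound[OF G(1,3)])
      fix p assume p: "p \<in> ?N"
      have "(\<Sum>x\<in>?N. (1 - ?cov x / c) * indicator {x} p) = (\<Sum>x\<in>?N. if x = p then 1 - ?cov x / c else 0)"
        by (intro sum.cong) (auto simp: indicator_def)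
      also have "\<dots> = 1 - ?cov p / c" using p by simp
      finally show "(\<Sum>x\<in>K <+> ?N. ?w x * indicator (?S x) p) = 1"
        using K by (simp add: sum.Plus sum_divide_distrib)
    next
      fix x assume x: "x \<in> K <+> ?N"
      show "0 \<le> ?w x"
        using x by (rule PlusE) (simp_all only: sum.case slack divide_nonneg_pos w 2)
      show "?S x \<subseteq> ?N"
        using x by (rule PlusE) (simp_all add: S)
    qed (use K in simp)
    moreover have "0 \<le> (\<Sum>p\<in>?N. (1 - ?cov p / c) * worth G {p})"
      using slack by (intro sum_nonneg mult_nonneg_nonneg nonneg_gameD[OF G(2)]) auto
    ultimately have "(\<Sum>k\<in>K. w k * worth G (S k)) / c \<le> worth G ?N"
      using K by (simp add: sum.Plus sum_divide_distrib)
    then show ?thesis using 2 by (simp add: field_simps)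
  qed
qed

lemma balanced_perm_game:
  assumes G: "G \<in> games" "balanced_game G" and \<sigma>: "\<sigma> permutes pset G"
  shows "balanced_game (perm_game \<sigma> G)"
  unfolding balanced_game_def
proof (intro allI impI)
  fix \<B> l assume "balancing_weights (pset (perm_game \<sigma> G)) \<B> l"
  then have \<B>: "\<B> \<subseteq> Pow (pset G)" "\<And>S. S \<in> \<B> \<Longrightarrow> 0 < l S"
    "\<And>p. p \<in> pset G \<Longrightarrow> (\<Sum>S\<in>\<B>. l S * indicator S p) = 1"
    by (auto simp: balancing_weights_def)
  have "(\<Sum>S\<in>\<B>. l S * worth (perm_game \<sigma> G) S) = (\<Sum>S\<in>\<B>. l S * worth G (inv \<sigma> ` S))"
    using \<B>(1) by (intro sum.cong) auto
  also have "\<dots> \<le> worth G (pset G)"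
  proof (rule balanced_family_bound[OF G])
    show "finite \<B>" using \<B>(1) finite_subset by blast
    fix p assume p: "p \<in> pset G"
    have "p \<in> inv \<sigma> ` S \<longleftrightarrow> \<sigma> p \<in> S" for S
    proof
      assume "p \<in> inv \<sigma> ` S"
      then show "\<sigma> p \<in> S" by (auto simp: permutes_inverses[OF \<sigma>])
    next
      assume "\<sigma> p \<in> S"
      then have "inv \<sigma> (\<sigma> p) \<in> inv \<sigma> ` S" by (rule imageI)
      then show "p \<in> inv \<sigma> ` S" by (simp only: permutes_inverses[OF \<sigma>])
    qed
    then have "indicator (inv \<sigma> ` S) p = (indicator S (\<sigma> p) :: real)" for S
      by (simp add: indicator_def)
    moreover have "\<sigma> p \<in> pset G" using p permutes_in_image[OF \<sigma>] by simp
    ultimately show "(\<Sum>S\<in>\<B>. l S * indicator (inv \<sigma> ` S) p) = 1"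
      using \<B>(3)[of "\<sigma> p"] by simp
  next
    fix S assume S: "S \<in> \<B>"
    show "0 \<le> l S" using \<B>(2)[OF S] by simp
    show "inv \<sigma> ` S \<subseteq> pset G"
      using \<B>(1) S inv_permutes_image_subset[OF \<sigma>] by blast
  qed
  also have "\<dots> = worth (perm_game \<sigma> G) (pset (perm_game \<sigma> G))"
    by (simp add: permutes_image[OF permutes_inv[OF \<sigma>]])
  finally show "(\<Sum>S\<in>\<B>. l S * worth (perm_game \<sigma> G) S) \<le> \<dots>" .
qed

lemma (in composable) balanced_comp:
  assumes g: "nonneg_game G" "balanced_game G"
    and h: "nonneg_game H" "monotone_game H" "balanced_game H"
  shows "balanced_game (game_comp G i H)"
  unfolding balanced_game_def
proof (intro allI impI)
  fix \<B> l assume "balancing_weights (pset (game_comp G i H)) \<B> l"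
  then have \<B>: "\<B> \<subseteq> Pow (pset (game_comp G i H))" "\<And>S. S \<in> \<B> \<Longrightarrow> 0 < l S"
    "\<And>p. p \<in> pset (game_comp G i H) \<Longrightarrow> (\<Sum>S\<in>\<B>. l S * indicator S p) = 1"
    by (auto simp: balancing_weights_def)
  have fin: "finite \<B>" using \<B>(1) finite_subset by blast
  let ?P = "pset G - {i}" and ?Q = "pset H"
  let ?b = "\<lambda>S. worth H (S \<inter> ?Q)"
  have b: "0 \<le> ?b S" "?b S \<le> worth H ?Q" for S
    using h by (auto simp: nonneg_game_def monotone_game_def)
  \<comment> \<open>This bounds the total weight with which the player \<open>i\<close> will be covered.\<close>
  have inner: "(\<Sum>S\<in>\<B>. l S * ?b S) \<le> 1 * worth H ?Q"
  proof (rule balanced_packing_bound[OF H h(1,3) fin])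
    fix p assume p: "p \<in> ?Q"
    have "(\<Sum>S\<in>\<B>. l S * indicator (S \<inter> ?Q) p) = (\<Sum>S\<in>\<B>. l S * indicator S p)"
      using p by (intro sum.cong) (auto simp: indicator_def)
    then show "(\<Sum>S\<in>\<B>. l S * indicator (S \<inter> ?Q) p) \<le> 1"
      using \<B>(3) p by (simp add: pset_comp)
  qed (use \<B> in \<open>auto simp: less_imp_le\<close>)
  \<comment> \<open>Each coalition \<open>S\<close> enters the outer game twice, once with and once without \<open>i\<close>; its weight
    \<open>l S\<close> is split in proportion to the inner worth of \<open>S\<close>.\<close>
  define w where "w = (\<lambda>(S, joined). l S * (if joined then ?b S else worth H ?Q - ?b S))"
  define C where "C = (\<lambda>(S, joined). if joined then insert i (S \<inter> ?P) else S \<inter> ?P)"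
  have split: "(\<Sum>x\<in>\<B> \<times> UNIV. w x * f (C x)) = (\<Sum>S\<in>\<B>. l S *
      ((worth H ?Q - ?b S) * f (S \<inter> ?P) + ?b S * f (insert i (S \<inter> ?P))))" for f
    by (simp add: sum.cartesian_product' w_def C_def UNIV_bool algebra_simps)
  have "(\<Sum>x\<in>\<B> \<times> UNIV. w x * worth G (C x)) \<le> worth H ?Q * worth G (pset G)"
  proof (rule balanced_packing_bound[OF G g])
    fix p assume p: "p \<in> pset G"
    show "(\<Sum>x\<in>\<B> \<times> UNIV. w x * indicator (C x) p) \<le> worth H ?Q"
    proof (cases "p = i")
      case True
      then have "(\<Sum>x\<in>\<B> \<times> UNIV. w x * indicator (C x) p) = (\<Sum>S\<in>\<B>. l S * ?b S)"
        unfolding split[of "\<lambda>T. indicator T p"] by simp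
      then show ?thesis using inner by simp
    next
      case False
      then have "(\<Sum>x\<in>\<B> \<times> UNIV. w x * indicator (C x) p) =
          (\<Sum>S\<in>\<B>. worth H ?Q * (l S * indicator S p))"
        unfolding split[of "\<lambda>T. indicator T p"] using p
        by (intro sum.cong) (auto simp: indicator_def)
      also have "\<dots> = worth H ?Q"
        using \<B>(3)[of p] p False by (simp add: sum_distrib_left[symmetric] pset_comp)
      finally show ?thesis by simp
    qed
  qed (use fin \<B> b i in \<open>auto simp: w_def C_def less_imp_le split: if_splits\<close>)
  moreover have "(\<Sum>S\<in>\<B>. l S * worth (game_comp G i H) S) = (\<Sum>x\<in>\<B> \<times> UNIV. w x * worth G (C x))"
    unfolding split using \<B>(1) by (intro sum.cong) (auto simp: worth_comp)
  ultimately show "(\<Sum>S\<in>\<B>. l S * worth (game_comp G i H) S) \<le>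
      worth (game_comp G i H) (pset (game_comp G i H))"
    by (simp add: comp_grand_worth mult.commute)
qed

lemma balanced_unit_game: "balanced_game (unit_game a)"
  unfolding balanced_game_def
proof (intro allI impI)
  fix \<B> l assume B: "balancing_weights (pset (unit_game a)) \<B> l"
  then have "(\<Sum>S\<in>\<B>. l S * worth (unit_game a) S) = (\<Sum>S\<in>\<B>. l S * indicator S a)"
    by (intro sum.cong) (auto simp: balancing_weights_def)
  then show "(\<Sum>S\<in>\<B>. l S * worth (unit_game a) S) \<le> worth (unit_game a) (pset (unit_game a))"
    using B by (simp add: balancing_weights_def)
qed

lemma suboperad_balanced_capacities:
  "suboperad {G \<in> games. nonneg_game G \<and> monotone_game G \<and> balanced_game G}"
proof (rule suboperadI)
  fix G i and H :: "'a game"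
  assume "composable G i H" "nonneg_game G \<and> monotone_game G \<and> balanced_game G"
    "nonneg_game H \<and> monotone_game H \<and> balanced_game H"
  then show "nonneg_game (game_comp G i H) \<and> monotone_game (game_comp G i H) \<and>
      balanced_game (game_comp G i H)"
    by (simp add: composable.nonneg_comp composable.monotone_comp composable.balanced_comp)
qed (simp_all add: nonneg_unit_game monotone_unit_game balanced_unit_game
      nonneg_perm_game monotone_perm_game balanced_perm_game)

theorem theorem3:
  "suboperad {G \<in> (games :: 'a game set). normalized G} \<and>
   suboperad {G \<in> (games :: 'a game set). simple_game G \<and> monotone_game G} \<and>
   suboperad {G \<in> (games :: 'a game set). nonneg_game G \<and> monotone_game G} \<and>
   suboperad {G \<in> (games :: 'a game set). nonneg_game G \<and> convex_game G} \<and>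
   (\<forall>k\<ge>2. suboperad {G \<in> (games :: 'a game set). nonneg_game G \<and> k_monotone k G}) \<and>
   suboperad {G \<in> (games :: 'a game set). nonneg_game G \<and> monotone_game G \<and> submodular_game G} \<and>
   (\<forall>k\<ge>2. suboperad {G \<in> (games :: 'a game set).
              nonneg_game G \<and> monotone_game G \<and> k_alternating k G}) \<and>
   suboperad {G \<in> (games :: 'a game set). nonneg_game G \<and> inf_monotone G} \<and>
   suboperad {G \<in> (games :: 'a game set).
              nonneg_game G \<and> monotone_game G \<and> inf_alternating G} \<and>
   suboperad {G \<in> (games :: 'a game set). nonneg_game G \<and> monotone_game G \<and> balanced_game G}"
proof (intro conjI allI impI)
  show "suboperad {G \<in> (games :: 'a game set). nonneg_game G \<and> convex_game G}"
    using suboperad_k_monotone[of 2] by (simp add: two_monotone_iff_convex)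
  show "suboperad {G \<in> (games :: 'a game set).
      nonneg_game G \<and> monotone_game G \<and> submodular_game G}"
    using suboperad_k_alternating[of 2] by (simp add: two_alternating_iff_submodular)
  show "suboperad {G \<in> (games :: 'a game set). nonneg_game G \<and> inf_monotone G}"
    unfolding inf_monotone_def by (intro suboperad_all_orders suboperad_k_monotone)
  show "suboperad {G \<in> (games :: 'a game set).
      nonneg_game G \<and> monotone_game G \<and> inf_alternating G}"
    unfolding inf_alternating_def
    by (rule suboperad_all_orders[of "\<lambda>G. nonneg_game G \<and> monotone_game G" k_alternating,
          unfolded conj_assoc])
      (rule suboperad_k_alternating)
qed (simp_all add: suboperad_normalized suboperad_simple_monotone suboperad_capacities
    suboperad_k_monotone suboperad_k_alternating suboperad_balanced_capacities)

end
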